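(* Let $D$ be sparse and let $x\in[0,1]$ be such that $C(x)$ is not empty. Then $x$ is translation equivalent to a rational $t\in[0,1]$ if and only if there exists $\varepsilon>0$ such that $C(x)\cap[0,\varepsilon]$ is a self-similar set generated by a finite set of similarities $f_j(y)=r_jy+b_j$, where $r_j=n^{-q_j}$ for some $q_j\in\mathbb{N}$.
   Context: Let $n\ge 3$ be an integer and let $D=\{d_1<d_2<\cdots<d_m\}\subseteq\{0,1,\ldots,n-1\}$ be a digit set with $2\le m<n$ and $d_1=0$. Put $C=C_{n,D}:=\{\sum_{k=1}^\infty x_k n^{-k} : x_k\in D \text{ for all } k\in\mathbb{N}\}$, where $\mathbb{N}=\{1,2,\ldots\}$, and $\Delta:=D-D=\{d_j-d_k : d_j,d_k\in D\}$. $D$ is sparse if $|\delta-\delta'|\ge 2$ for all $\delta\ne\delta'$ in $\Delta$. For $t\in\mathbb{R}$, $C+t:=\{x+t : x\in C\}$; if $C\cap(C+t)\neq\varnothing$ let $C(t):=(C\cap(C+t))-\inf(C\cap(C+t))$, otherwise $C(t):=\varnothing$. Real numbers $s,t$ are translation equivalent if $C(s)=C(t)$. A self-similar set generated by finitely many similarities $f_1,\ldots,f_\ell$ of $\mathbb{R}$, $f_j(y)=r_jy+b_j$ with $0<|r_j|<1$, is the unique non-empty compact set $T$ with $T=\bigcup_{j} f_j(T)$ (no separation condition is required). *)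

theory Defs
  imports "HOL-Analysis.Analysis"
begin

(* Digit positions are k = 1, 2, ..., whereas suminf starts at 0; hence Suc k.
   The series converges whenever D is bounded and n > 1. *)
definition cantor_set :: "nat \<Rightarrow> nat set \<Rightarrow> real set" where
  "cantor_set n D =
     {\<Sum>k. real (x (Suc k)) / real n ^ Suc k | x :: nat \<Rightarrow> nat. \<forall>k\<ge>1. x k \<in> D}"

(* Differences are taken in int: subtraction on nat truncates. *)
definition digit_differences :: "nat set \<Rightarrow> int set" where
  "digit_differences D = {int d - int e | d e. d \<in> D \<and> e \<in> D}"

definition sparse_digits :: "nat set \<Rightarrow> bool" where
  "sparse_digits D \<longleftrightarrow>
     (\<forall>\<delta>\<in>digit_differences D. \<forall>\<delta>'\<in>digit_differences D. \<delta> \<noteq> \<delta>' \<longrightarrow> \<bar>\<delta> - \<delta>'\<bar> \<ge> 2)"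

definition translate :: "real set \<Rightarrow> real \<Rightarrow> real set" where
  "translate A t = (\<lambda>y. y + t) ` A"

definition translate_inter :: "nat \<Rightarrow> nat set \<Rightarrow> real \<Rightarrow> real set" where
  "translate_inter n D t =
     (let A = cantor_set n D \<inter> translate (cantor_set n D) t
      in if A \<noteq> {} then (\<lambda>y. y - Inf A) ` A else {})"

definition translation_equivalent :: "nat \<Rightarrow> nat set \<Rightarrow> real \<Rightarrow> real \<Rightarrow> bool" where
  "translation_equivalent n D s t \<longleftrightarrow> translate_inter n D s = translate_inter n D t"

definition contracting_similarity :: "(real \<Rightarrow> real) \<Rightarrow> bool" where
  "contracting_similarity f \<longleftrightarrow> (\<exists>r b. 0 < \<bar>r\<bar> \<and> \<bar>r\<bar> < 1 \<and> f = (\<lambda>y. r * y + b))"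

(* The attractor of F is characterised by its defining properties; that it is the
   only such set is Hutchinson's theorem.  F is non-empty because T is. *)
definition self_similar_set_generated_by :: "(real \<Rightarrow> real) set \<Rightarrow> real set \<Rightarrow> bool" where
  "self_similar_set_generated_by F T \<longleftrightarrow>
     finite F \<and> (\<forall>f\<in>F. contracting_similarity f) \<and>
     T \<noteq> {} \<and> compact T \<and> T = (\<Union>f\<in>F. f ` T)"

end

theory Submission
  imports Defs
begin

text \<open>
  The points of \<open>C \<inter> (C + x)\<close> are read off the base-\<open>n\<close> expansions of \<open>x\<close> with digits in \<open>\<Delta>\<close>.
  Sparseness makes such an expansion \<open>t\<close> unique, except for certain rational \<open>x\<close> for which
  \<open>C(x)\<close> is finite. If \<open>t\<close> is unique, then \<open>C(x)\<close> consists of all sums \<open>\<Sum> e\<^sub>k n\<^sup>-\<^sup>k\<close> with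
  \<open>e\<^sub>k \<in> E\<^sub>k\<close>, where \<open>E\<^sub>k\<close> is \<open>D \<inter> (D + t\<^sub>k)\<close> moved to start at 0. A rational \<open>x\<close> has an
  eventually periodic \<open>t\<close>, and a period of the \<open>E\<^sub>k\<close> yields the similarities. Conversely, a
  system generating \<open>C(x) \<inter> [0,\<epsilon>]\<close> contains some \<open>y \<mapsto> n\<^sup>-\<^sup>q y\<close>, so that
  \<open>E\<^sub>k \<subseteq> E\<^sub>k\<^sub>+\<^sub>q\<close> for large \<open>k\<close>; these being subsets of a finite set, \<open>E\<^sub>k\<close> is eventually
  periodic, and a periodic choice of digits with the same \<open>E\<^sub>k\<close> gives the rational number.
\<close>

section \<open>Series of digits\<close>

locale radix =
  fixes n :: nat
  assumes two_le_n: "2 \<le> n"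
begin

text \<open>Positions count from 0, so index \<open>k\<close> carries the weight of digit number
  \<open>k + 1\<close>. Integer digits allow differences of digits; the bounds assumed in the lemmas
  below guarantee convergence.\<close>

definition val :: "(nat \<Rightarrow> int) \<Rightarrow> real" where
  "val a = (\<Sum>k. real_of_int (a k) / real n ^ Suc k)"

lemma n_pos: "0 < real n" and n_gt_1: "1 < real n"
  using two_le_n by auto

lemma summable_val:
  assumes "\<And>k. \<bar>a k\<bar> \<le> B"
  shows "summable (\<lambda>k. real_of_int (a k) / real n ^ Suc k)"
proof (rule summable_comparison_test')
  have "summable (\<lambda>k. (1 / real n) ^ k)"
    using n_gt_1 by (intro summable_geometric) auto
  then show "summable (\<lambda>k. real_of_int B / real n * (1 / real n) ^ k)"
    by (rule summable_mult)
  fix k :: nat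
  have "\<bar>real_of_int (a k)\<bar> \<le> real_of_int B"
    using assms[of k] by linarith
  then show "norm (real_of_int (a k) / real n ^ Suc k) \<le> real_of_int B / real n * (1 / real n) ^ k"
    using n_pos by (simp add: field_simps)
qed

text \<open>The base-\<open>n\<close> form of 0.999... = 1, multiplied by \<open>c\<close>. All
  estimates of digit series are comparisons with this one.\<close>

lemma val_const: "val (\<lambda>_. c * (int n - 1)) = real_of_int c"
proof -
  have "(\<lambda>k. (1 / real n) ^ k) sums (1 / (1 - 1 / real n))"
    using n_gt_1 by (intro geometric_sums) auto
  then have "(\<lambda>k. real_of_int (c * (int n - 1)) / real n * (1 / real n) ^ k) sums
      (real_of_int (c * (int n - 1)) / real n * (1 / (1 - 1 / real n)))"
    by (rule sums_mult)
  moreover have "real_of_int (c * (int n - 1)) / real n * (1 / (1 - 1 / real n)) = real_of_int c"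
    using n_gt_1 by (simp add: field_simps)
  ultimately show ?thesis
    unfolding val_def by (intro sums_unique[symmetric]) (simp add: field_simps)
qed

lemma val_add:
  assumes "\<And>k. \<bar>a k\<bar> \<le> A" "\<And>k. \<bar>b k\<bar> \<le> B"
  shows "val (\<lambda>k. a k + b k) = val a + val b"
  unfolding val_def suminf_add[OF summable_val[of a, OF assms(1)] summable_val[of b, OF assms(2)]]
  by (simp add: add_divide_distrib)

lemma val_uminus:
  assumes "\<And>k. \<bar>a k\<bar> \<le> A"
  shows "val (\<lambda>k. - a k) = - val a"
  unfolding val_def using suminf_minus[OF summable_val[of a, OF assms(1)]] by simp

lemma val_diff:
  assumes "\<And>k. \<bar>a k\<bar> \<le> A" "\<And>k. \<bar>b k\<bar> \<le> B"
  shows "val (\<lambda>k. a k - b k) = val a - val b"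
  using val_add[of a A "\<lambda>k. - b k" B] val_uminus[of b B] assms by simp

lemma val_nonneg:
  assumes "\<And>k. \<bar>a k\<bar> \<le> A" "\<And>k. 0 \<le> a k"
  shows "0 \<le> val a"
  unfolding val_def using assms n_pos by (intro suminf_nonneg summable_val[of a]) auto

lemma val_mono:
  assumes "\<And>k. \<bar>a k\<bar> \<le> A" "\<And>k. \<bar>b k\<bar> \<le> B" "\<And>k. a k \<le> b k"
  shows "val a \<le> val b"
proof -
  have "\<bar>b k - a k\<bar> \<le> A + B" for k
    using assms(1,2)[of k] by linarith
  then have "0 \<le> val (\<lambda>k. b k - a k)"
    using assms(3) by (intro val_nonneg) auto
  then show ?thesis
    using val_diff[OF assms(2,1)] by simp
qed

lemma val_eq_0_iff:
  assumes "\<And>k. \<bar>a k\<bar> \<le> A" "\<And>k. 0 \<le> a k"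
  shows "val a = 0 \<longleftrightarrow> (\<forall>k. a k = 0)"
proof -
  have "val a = 0 \<longleftrightarrow> (\<forall>k. real_of_int (a k) / real n ^ Suc k = 0)"
    unfolding val_def using assms n_pos by (intro suminf_eq_zero_iff summable_val[of a]) auto
  then show ?thesis
    using n_pos by simp
qed

lemma val_le:
  assumes "\<And>k. \<bar>a k\<bar> \<le> A" "\<And>k. a k \<le> c * (int n - 1)"
  shows "val a \<le> real_of_int c"
  using val_mono[of a A "\<lambda>_. c * (int n - 1)" "\<bar>c * (int n - 1)\<bar>"] assms val_const by simp

lemma abs_val_le:
  assumes "\<And>k. \<bar>a k\<bar> \<le> c * (int n - 1)"
  shows "\<bar>val a\<bar> \<le> real_of_int c"
proof -
  have "a k \<le> c * (int n - 1)" "- a k \<le> c * (int n - 1)" for k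
    using assms[of k] by linarith+
  then have "val a \<le> real_of_int c" "val (\<lambda>k. - a k) \<le> real_of_int c"
    using assms by (intro val_le[of _ "c * (int n - 1)"]; simp)+
  then show ?thesis
    using val_uminus[OF assms] by simp
qed

lemma val_split:
  assumes "\<And>k. \<bar>a k\<bar> \<le> A"
  shows "val a = (\<Sum>k<N. real_of_int (a k) / real n ^ Suc k) + val (\<lambda>k. a (k + N)) / real n ^ N"
proof -
  have "val (\<lambda>k. a (k + N)) / real n ^ N = (\<Sum>k. real_of_int (a (k + N)) / real n ^ Suc (k + N))"
    unfolding val_def
    by (subst suminf_divide[OF summable_val[of _ A], symmetric]) (auto simp: assms power_add field_simps)
  then show ?thesis
    unfolding val_def using suminf_split_initial_segment[OF summable_val[of a, OF assms], of N] by simp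
qed

lemma val_eq_tail:
  assumes "\<And>k. \<bar>a k\<bar> \<le> A" "\<And>k. k < N \<Longrightarrow> a k = 0"
  shows "val a = val (\<lambda>k. a (k + N)) / real n ^ N"
  using val_split[of a A N] assms by simp

lemma val_single: "val (\<lambda>i. if i = k then e else 0) = real_of_int e / real n ^ Suc k"
proof -
  have "(\<lambda>i. real_of_int (if i = k then e else 0) / real n ^ Suc i) =
      (\<lambda>i. if i = k then real_of_int e / real n ^ Suc i else 0)"
    by auto
  then show ?thesis
    unfolding val_def using sums_unique[OF sums_single[of k "\<lambda>i. real_of_int e / real n ^ Suc i"]] by simp
qed

section \<open>Integrality and rationality of digit series\<close>

lemma initial_sum_Ints:
  "real n ^ N * (\<Sum>k<N. real_of_int (a k) / real n ^ Suc k) \<in> \<int>"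
  unfolding sum_distrib_left
proof (rule Ints_sum)
  fix k assume "k \<in> {..<N}"
  then have "real n ^ N = real n ^ (N - Suc k) * real n ^ Suc k"
    by (metis Suc_leI lessThan_iff le_add_diff_inverse2 power_add)
  then have "real n ^ N * (real_of_int (a k) / real n ^ Suc k) = real n ^ (N - Suc k) * real_of_int (a k)"
    using n_pos by simp
  then show "real n ^ N * (real_of_int (a k) / real n ^ Suc k) \<in> \<int>"
    by simp
qed

lemma val_const_tail_Ints:
  assumes "\<And>k. \<bar>a k\<bar> \<le> A" "\<And>k. k \<ge> N \<Longrightarrow> a k = c * (int n - 1)"
  shows "real n ^ N * val a \<in> \<int>"
proof -
  have "(\<lambda>k. a (k + N)) = (\<lambda>_. c * (int n - 1))"
    using assms(2) by auto
  then have "real n ^ N * val a =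
      real n ^ N * (\<Sum>k<N. real_of_int (a k) / real n ^ Suc k) + real_of_int c"
    using val_split[of a A N] assms(1) val_const n_pos by (simp add: field_simps)
  then show ?thesis
    using initial_sum_Ints by simp
qed

lemma Rats_of_power_mult_Ints:
  assumes "real n ^ N * y \<in> \<int>"
  shows "y \<in> \<rat>"
proof -
  have "y = real n ^ N * y / real n ^ N"
    using n_pos by simp
  also have "\<dots> \<in> \<rat>"
    using assms Ints_subset_Rats by (intro Rats_divide) auto
  finally show ?thesis .
qed

text \<open>The periodic tail \<open>u\<close> solves \<open>u = s + u / n ^ p\<close> with
  \<open>s\<close> rational, and \<open>n ^ p > 1\<close> lets the equation be solved for
  \<open>u\<close>.\<close>

lemma val_eventually_periodic_Rats:
  assumes "\<And>k. \<bar>a k\<bar> \<le> A" "0 < p" "\<And>k. k \<ge> N \<Longrightarrow> a (k + p) = a k"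
  shows "val a \<in> \<rat>"
proof -
  define u where "u = val (\<lambda>k. a (k + N))"
  define s where "s = (\<Sum>k<p. real_of_int (a (k + N)) / real n ^ Suc k)"
  have "(\<lambda>k. a (k + p + N)) = (\<lambda>k. a (k + N))"
    using assms(3)[of "k + N" for k] by (simp add: ac_simps)
  then have "u = s + u / real n ^ p"
    using val_split[of "\<lambda>k. a (k + N)" A p] assms(1) unfolding u_def s_def by simp
  then have "u * real n ^ p = s * real n ^ p + u"
    using n_pos by (metis add_divide_eq_iff nonzero_eq_divide_eq power_not_zero less_irrefl)
  moreover have "1 < real n ^ p"
    using n_gt_1 assms(2) by (simp add: one_less_power)
  ultimately have "u = s * real n ^ p / (real n ^ p - 1)"
    by (simp add: eq_divide_eq algebra_simps)
  moreover have "s \<in> \<rat>"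
    unfolding s_def using Rats_of_power_mult_Ints[OF initial_sum_Ints] .
  ultimately have "u \<in> \<rat>"
    by simp
  moreover have "(\<Sum>k<N. real_of_int (a k) / real n ^ Suc k) \<in> \<rat>"
    using Rats_of_power_mult_Ints[OF initial_sum_Ints] .
  ultimately show ?thesis
    using val_split[of a A N] assms(1) unfolding u_def by simp
qed

text \<open>Measured in units of place \<open>j\<close>, the later digits contribute at least -2,
  and exactly -2 only if each of them is as small as the bound permits. Cancelling a leading digit
  of at least 2 needs this extreme case.\<close>

lemma tail_extreme_of_val_eq_0:
  assumes bound: "\<And>k. \<bar>a k\<bar> \<le> 2 * (int n - 1)" and "val a = 0"
    and "\<And>i. i < j \<Longrightarrow> a i = 0" and "2 \<le> a j" and "j < k"
  shows "a k = - 2 * (int n - 1)"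
proof -
  \<comment> \<open>Raising the tail by its bound makes its digits nonnegative, so that value 0
    forces each of them to be 0.\<close>
  define b where "b k = 2 * (int n - 1) + a (k + Suc j)" for k
  have b: "0 \<le> b k" "\<bar>b k\<bar> \<le> 4 * (int n - 1)" for k
    using bound[of "k + Suc j"] unfolding b_def by linarith+
  have "val a = real_of_int (a j) / real n ^ Suc j + val (\<lambda>k. a (k + Suc j)) / real n ^ Suc j"
    using val_split[of a _ "Suc j", OF bound] assms(3) by simp
  then have "real_of_int (a j) + val (\<lambda>k. a (k + Suc j)) = 0"
    using \<open>val a = 0\<close> n_pos by (simp add: field_simps)
  moreover have "val b = 2 + val (\<lambda>k. a (k + Suc j))"
    unfolding b_def using val_const[of 2] bound
    by (subst val_add[of _ "\<bar>2 * (int n - 1)\<bar>" _ "2 * (int n - 1)"]) auto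
  moreover have "0 \<le> val b"
    using b by (rule val_nonneg[rotated])
  ultimately have "val b = 0"
    using \<open>2 \<le> a j\<close> by linarith
  then have "b (k - Suc j) = 0"
    using val_eq_0_iff[of b, OF b(2,1)] by blast
  then show ?thesis
    using \<open>j < k\<close> unfolding b_def by simp
qed

section \<open>Sets of digit series and their compactness\<close>

definition digit_values :: "(nat \<Rightarrow> int set) \<Rightarrow> real set" where
  "digit_values E = val ` {e. \<forall>k. e k \<in> E k}"

lemma digit_valuesI: "(\<And>k. e k \<in> E k) \<Longrightarrow> val e \<in> digit_values E"
  unfolding digit_values_def by blast

text \<open>Partial sums depend on finitely many coordinates and converge uniformly by the
  Weierstrass test. Digits are real here in order to use the product topology on real
  sequences.\<close>

lemma continuous_on_val:
  "continuous_on {a. \<forall>k. \<bar>a k\<bar> \<le> B} (\<lambda>a :: nat \<Rightarrow> real. \<Sum>k. a k / real n ^ Suc k)"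
proof (rule uniform_limit_theorem[where F = sequentially])
  show "\<forall>\<^sub>F N in sequentially. continuous_on {a. \<forall>k. \<bar>a k\<bar> \<le> B} (\<lambda>a. \<Sum>k<N. a k / real n ^ Suc k)"
    using n_pos
    by (intro always_eventually allI continuous_intros
        continuous_on_subset[OF continuous_on_product_coordinates]) auto
  have "summable (\<lambda>k. (1 / real n) ^ k)"
    using n_gt_1 by (intro summable_geometric) auto
  then have "summable (\<lambda>k. B / real n * (1 / real n) ^ k)"
    by (rule summable_mult)
  then show "uniform_limit {a. \<forall>k. \<bar>a k\<bar> \<le> B} (\<lambda>N a. \<Sum>k<N. a k / real n ^ Suc k)
      (\<lambda>a. \<Sum>k. a k / real n ^ Suc k) sequentially"
    using n_pos by (intro Weierstrass_m_test) (auto simp: field_simps)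
qed simp

text \<open>A product of finite digit sets is compact by Tychonoff, and the set in question is its
  continuous image.\<close>

lemma compact_digit_values:
  assumes "\<And>k. finite (E k)" "\<And>k e. e \<in> E k \<Longrightarrow> \<bar>e\<bar> \<le> B"
  shows "compact (digit_values E)"
proof -
  define P :: "(nat \<Rightarrow> real) set" where "P = (\<Pi>\<^sub>E k\<in>UNIV. real_of_int ` E k)"
  have "compactin (product_topology (\<lambda>_. euclidean) UNIV) P"
    unfolding P_def using assms(1) by (simp add: compactin_PiE finite_imp_compact)
  then have "compact P"
    by (simp add: euclidean_product_topology)
  moreover have "P \<subseteq> {a. \<forall>k. \<bar>a k\<bar> \<le> real_of_int B}"
  proof
    fix a assume a: "a \<in> P"
    have "\<bar>a k\<bar> \<le> real_of_int B" for k
    proof -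
      obtain e where "e \<in> E k" "a k = real_of_int e"
        using a by (auto simp: P_def PiE_iff)
      then show ?thesis
        using assms(2)[of e k] by linarith
    qed
    then show "a \<in> {a. \<forall>k. \<bar>a k\<bar> \<le> real_of_int B}"
      by blast
  qed
  then have "continuous_on P (\<lambda>a. \<Sum>k. a k / real n ^ Suc k)"
    by (rule continuous_on_subset[OF continuous_on_val])
  ultimately have "compact ((\<lambda>a. \<Sum>k. a k / real n ^ Suc k) ` P)"
    by (rule compact_continuous_image[rotated])
  moreover have "P = (\<lambda>e k. real_of_int (e k)) ` {e. \<forall>k. e k \<in> E k}"
  proof (intro equalityI subsetI)
    fix a assume "a \<in> P"
    then have "\<forall>k. \<exists>e. e \<in> E k \<and> a k = real_of_int e"
      by (auto simp: P_def PiE_iff)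
    then obtain e where "\<forall>k. e k \<in> E k \<and> a k = real_of_int (e k)"
      by metis
    then show "a \<in> (\<lambda>e k. real_of_int (e k)) ` {e. \<forall>k. e k \<in> E k}"
      by (intro image_eqI[of _ _ e]) auto
  qed (auto simp: P_def)
  ultimately show ?thesis
    by (simp add: digit_values_def val_def[abs_def] image_image)
qed

end

section \<open>Expansions with sparse digits\<close>

locale sparse_radix = radix +
  fixes D :: "nat set"
  assumes D_subset: "D \<subseteq> {0..n - 1}" and zero_in_D: "0 \<in> D" and sparse: "sparse_digits D"
begin

abbreviation \<Delta> :: "int set" where
  "\<Delta> \<equiv> digit_differences D"

lemma finite_D: "finite D"
  using finite_subset[OF D_subset] by simp

lemma D_bound: "d \<in> int ` D \<Longrightarrow> 0 \<le> d \<and> d \<le> int n - 1"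
  using D_subset two_le_n by auto

lemma diff_in_\<Delta>: "d \<in> int ` D \<Longrightarrow> e \<in> int ` D \<Longrightarrow> d - e \<in> \<Delta>"
  unfolding digit_differences_def by blast

lemma \<Delta>_E:
  assumes "\<delta> \<in> \<Delta>"
  obtains d e where "d \<in> int ` D" "e \<in> int ` D" "\<delta> = d - e"
  using assms unfolding digit_differences_def by blast

lemma \<Delta>_bound: "\<delta> \<in> \<Delta> \<Longrightarrow> \<bar>\<delta>\<bar> \<le> int n - 1"
proof (elim \<Delta>_E)
  fix d e assume "d \<in> int ` D" "e \<in> int ` D" "\<delta> = d - e"
  then show "\<bar>\<delta>\<bar> \<le> int n - 1"
    using D_bound[of d] D_bound[of e] by linarith
qed

lemma zero_in_\<Delta>: "0 \<in> \<Delta>"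
proof -
  have "0 \<in> int ` D"
    using zero_in_D by force
  then show ?thesis
    using diff_in_\<Delta>[of 0 0] by simp
qed

lemma uminus_in_\<Delta>: "\<delta> \<in> \<Delta> \<Longrightarrow> - \<delta> \<in> \<Delta>"
proof (erule \<Delta>_E)
  fix d e assume "d \<in> int ` D" "e \<in> int ` D" "\<delta> = d - e"
  then show "- \<delta> \<in> \<Delta>"
    using diff_in_\<Delta>[of e d] by simp
qed

lemma \<Delta>_sparse: "\<delta> \<in> \<Delta> \<Longrightarrow> \<delta>' \<in> \<Delta> \<Longrightarrow> \<delta> < \<delta>' \<Longrightarrow> \<delta> + 2 \<le> \<delta>'"
proof -
  assume "\<delta> \<in> \<Delta>" "\<delta>' \<in> \<Delta>" "\<delta> < \<delta>'"
  then have "2 \<le> \<bar>\<delta> - \<delta>'\<bar>"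
    by (intro sparse[unfolded sparse_digits_def, rule_format]) simp_all
  then show "\<delta> + 2 \<le> \<delta>'"
    using \<open>\<delta> < \<delta>'\<close> by simp
qed

text \<open>By sparseness the digits at the first difference \<open>j\<close> are at least 2 apart,
  so the difference \<open>t - s\<close> has the extreme tail \<open>- 2 * (n - 1)\<close>. As
  single digits have absolute value at most \<open>n - 1\<close>, both must be extreme.\<close>

lemma extreme_tails_of_less:
  assumes "\<And>k. s k \<in> \<Delta>" "\<And>k. t k \<in> \<Delta>" "val s = val t"
    and "\<And>i. i < j \<Longrightarrow> s i = t i" "s j < t j" "j < k"
  shows "s k = int n - 1 \<and> t k = - (int n - 1)"
proof -
  have b: "\<bar>s i\<bar> \<le> int n - 1" "\<bar>t i\<bar> \<le> int n - 1" for i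
    using \<Delta>_bound assms by auto
  have "\<bar>t i - s i\<bar> \<le> 2 * (int n - 1)" for i
    using abs_triangle_ineq4[of "t i" "s i"] add_mono[OF b(2)[of i] b(1)[of i]] by simp
  moreover have "val (\<lambda>k. t k - s k) = 0"
    using val_diff[OF b(2,1)] assms(3) by simp
  moreover have "2 \<le> t j - s j"
    using \<Delta>_sparse[of "s j" "t j"] assms by simp
  ultimately have "t k - s k = - 2 * (int n - 1)"
    using tail_extreme_of_val_eq_0[of "\<lambda>k. t k - s k" j k] assms by simp
  then show ?thesis
    using b[of k] by (auto simp: abs_le_iff)
qed

text \<open>The symmetric form: the sign \<open>c\<close> records which of the two sequences is
  smaller at the first difference \<open>j\<close>.\<close>

lemma extreme_tails:
  assumes "\<And>k. s k \<in> \<Delta>" "\<And>k. t k \<in> \<Delta>" "val s = val t" "s \<noteq> t"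
  obtains j c where "c = 1 \<or> c = -1" "s j \<noteq> t j" "\<forall>i<j. s i = t i"
    "\<forall>k>j. s k = c * (int n - 1)" "\<forall>k>j. t k = - c * (int n - 1)"
proof -
  define j where "j = (LEAST i. s i \<noteq> t i)"
  have "\<exists>i. s i \<noteq> t i"
    using assms(4) by auto
  then have j: "s j \<noteq> t j"
    unfolding j_def by (rule LeastI_ex)
  have less: "s i = t i" if "i < j" for i
    using not_less_Least that unfolding j_def by blast
  consider "s j < t j" | "t j < s j"
    using j by linarith
  then show thesis
  proof cases
    case 1
    then show thesis
      using extreme_tails_of_less[OF assms(1-3) less 1] less j by (intro that[of 1 j]) simp_all
  next
    case 2
    then show thesis
      using extreme_tails_of_less[OF assms(2,1) assms(3)[symmetric] less[symmetric] 2] less j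
      by (intro that[of "-1" j]) simp_all
  qed
qed

text \<open>Of two different expansions of a number, one would end in the negative digit
  \<open>- (n - 1)\<close>.\<close>

lemma nonneg_expansion_unique:
  assumes "\<And>k. s k \<in> \<Delta>" "\<And>k. t k \<in> \<Delta>" "val s = val t" "\<And>k. 0 \<le> s k" "\<And>k. 0 \<le> t k"
  shows "s = t"
proof (rule ccontr)
  assume "s \<noteq> t"
  show False
  proof (rule extreme_tails[OF assms(1-3) \<open>s \<noteq> t\<close>])
    fix j c assume "c = 1 \<or> c = -1" and s: "\<forall>k>j. s k = c * (int n - 1)"
      and t: "\<forall>k>j. t k = - c * (int n - 1)"
    then show False
      using assms(4,5)[of "Suc j"] s[rule_format, of "Suc j"] t[rule_format, of "Suc j"] two_le_n by auto
  qed
qed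

section \<open>Digits common to \<open>D\<close> and a translate of \<open>D\<close>\<close>

definition overlap :: "int \<Rightarrow> int set" where
  "overlap \<delta> = {d \<in> int ` D. d - \<delta> \<in> int ` D}"

definition overlap_digits :: "int \<Rightarrow> int set" where
  "overlap_digits \<delta> = (\<lambda>d. d - Min (overlap \<delta>)) ` overlap \<delta>"

lemma finite_overlap: "finite (overlap \<delta>)"
  unfolding overlap_def using finite_D by simp

lemma overlap_nonempty: "\<delta> \<in> \<Delta> \<Longrightarrow> overlap \<delta> \<noteq> {}"
proof (erule \<Delta>_E)
  fix d e assume "d \<in> int ` D" "e \<in> int ` D" "\<delta> = d - e"
  then have "d \<in> overlap \<delta>"
    unfolding overlap_def by simp
  then show ?thesis
    by blast
qed

lemma Min_overlap: "\<delta> \<in> \<Delta> \<Longrightarrow> Min (overlap \<delta>) \<in> overlap \<delta>"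
  using finite_overlap overlap_nonempty by (intro Min_in)

lemma overlap_bound: "d \<in> overlap \<delta> \<Longrightarrow> 0 \<le> d \<and> d \<le> int n - 1"
  unfolding overlap_def using D_bound by blast

text \<open>Two digits can differ by \<open>n - 1\<close> only if they are \<open>n - 1\<close> and
  0. Extreme tails of an expansion therefore leave no choice of digits.\<close>

lemma overlap_extreme:
  "overlap (int n - 1) \<subseteq> {int n - 1}" "overlap (- (int n - 1)) \<subseteq> {0}"
  using D_bound by (smt (verit) mem_Collect_eq overlap_def singletonI subsetI)+

lemma overlap_digits_nonneg: "e \<in> overlap_digits \<delta> \<Longrightarrow> 0 \<le> e"
  unfolding overlap_digits_def using finite_overlap by auto

lemma overlap_digits_in_\<Delta>: "\<delta> \<in> \<Delta> \<Longrightarrow> e \<in> overlap_digits \<delta> \<Longrightarrow> e \<in> \<Delta>"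
  unfolding overlap_digits_def using Min_overlap[of \<delta>] by (auto simp: overlap_def intro!: diff_in_\<Delta>)

lemma zero_in_overlap_digits: "\<delta> \<in> \<Delta> \<Longrightarrow> 0 \<in> overlap_digits \<delta>"
  unfolding overlap_digits_def using Min_overlap by force

text \<open>Exchanging the two digits of a pair moves the overlap by \<open>\<delta>\<close>, which
  the normalisation to least element 0 undoes. Signs in an expansion can thus be changed without
  changing the digit sets.\<close>

lemma overlap_digits_uminus:
  assumes "\<delta> \<in> \<Delta>"
  shows "overlap_digits (- \<delta>) = overlap_digits \<delta>"
proof -
  have eq: "overlap (- \<delta>) = (\<lambda>d. d - \<delta>) ` overlap \<delta>"
  proof (intro equalityI subsetI)
    fix d assume "d \<in> overlap (- \<delta>)"
    then show "d \<in> (\<lambda>d. d - \<delta>) ` overlap \<delta>"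
      by (intro image_eqI[of _ _ "d + \<delta>"]) (simp_all add: overlap_def)
  next
    fix d assume "d \<in> (\<lambda>d. d - \<delta>) ` overlap \<delta>"
    then obtain e where "e \<in> overlap \<delta>" "d = e - \<delta>"
      by blast
    then show "d \<in> overlap (- \<delta>)"
      by (simp add: overlap_def)
  qed
  have "mono (\<lambda>d. d - \<delta>)"
    by (auto intro: monoI)
  then have "Min (overlap (- \<delta>)) = Min (overlap \<delta>) - \<delta>"
    unfolding eq using mono_Min_commute[OF _ finite_overlap overlap_nonempty[OF assms]] by metis
  then show ?thesis
    unfolding overlap_digits_def by (simp add: eq image_image)
qed

section \<open>The intersection of the Cantor set with a translate\<close>

lemma cantor_set_eq: "cantor_set n D = digit_values (\<lambda>_. int ` D)"
proof (intro equalityI subsetI)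
  fix y assume "y \<in> cantor_set n D"
  then obtain a where "\<forall>k\<ge>1. a k \<in> D" "y = (\<Sum>k. real (a (Suc k)) / real n ^ Suc k)"
    unfolding cantor_set_def by blast
  then show "y \<in> digit_values (\<lambda>_. int ` D)"
    unfolding digit_values_def val_def
    \<comment> \<open>\<open>cantor_set\<close> numbers its digits from 1, \<open>val\<close> from
      0.\<close>
    by (intro image_eqI[of _ _ "\<lambda>k. int (a (Suc k))"]) auto
next
  fix y assume "y \<in> digit_values (\<lambda>_. int ` D)"
  then obtain a where a: "\<forall>k. a k \<in> int ` D" "y = val a"
    unfolding digit_values_def by blast
  then have "real_of_int (a k) = real (nat (a k))" for k
    by (metis D_bound of_int_of_nat_eq nat_0_le)
  then have "y = (\<Sum>k. real (nat (a (Suc k - 1))) / real n ^ Suc k)"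
    unfolding a val_def by simp
  moreover have "\<forall>k\<ge>1. nat (a (k - 1)) \<in> D"
    using a(1) by (metis image_iff nat_int)
  ultimately show "y \<in> cantor_set n D"
    unfolding cantor_set_def by (intro CollectI exI[of _ "\<lambda>k. nat (a (k - 1))"]) simp
qed

definition expansions :: "real \<Rightarrow> (nat \<Rightarrow> int) set" where
  "expansions x = {t. (\<forall>k. t k \<in> \<Delta>) \<and> val t = x}"

text \<open>If \<open>v = val y\<close> and \<open>v = val z + x\<close> with digits in
  \<open>D\<close>, then \<open>t = y - z\<close> is an expansion of \<open>x\<close> and each
  \<open>y k\<close> lies in \<open>overlap (t k)\<close>. Conversely, \<open>z\<close> is recovered
  as \<open>y - t\<close>.\<close>

lemma cantor_inter_translate:
  "cantor_set n D \<inter> translate (cantor_set n D) x = (\<Union>t\<in>expansions x. digit_values (\<lambda>k. overlap (t k)))"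
proof (intro equalityI subsetI)
  have b: "\<bar>y k\<bar> \<le> int n - 1" if "\<And>k. y k \<in> int ` D" for y :: "nat \<Rightarrow> int" and k
    using D_bound[OF that[of k]] by linarith
  {
    fix v assume "v \<in> cantor_set n D \<inter> translate (cantor_set n D) x"
    then obtain y z where y: "\<forall>k. y k \<in> int ` D" "v = val y" and z: "\<forall>k. z k \<in> int ` D" "v = val z + x"
      unfolding cantor_set_eq digit_values_def translate_def by auto
    define t where "t k = y k - z k" for k
    have "val t = x"
      unfolding t_def using val_diff[OF b[where y = y] b[where y = z]] y z by simp
    then have "t \<in> expansions x"
      using y z unfolding expansions_def t_def by (auto intro: diff_in_\<Delta>)
    moreover have "\<forall>k. y k \<in> overlap (t k)"
      using y z unfolding overlap_def t_def by auto
    ultimately show "v \<in> (\<Union>t\<in>expansions x. digit_values (\<lambda>k. overlap (t k)))"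
      using y unfolding digit_values_def by blast
  next
    fix v assume "v \<in> (\<Union>t\<in>expansions x. digit_values (\<lambda>k. overlap (t k)))"
    then obtain t y where t: "t \<in> expansions x" and y: "\<forall>k. y k \<in> overlap (t k)" "v = val y"
      unfolding digit_values_def by blast
    define z where "z k = y k - t k" for k
    have D: "\<And>k. y k \<in> int ` D" "\<And>k. z k \<in> int ` D"
      using y unfolding z_def overlap_def by auto
    have "val t = val y - val z"
      using val_diff[of y _ z, OF b[where y = y, OF D(1)] b[where y = z, OF D(2)]] unfolding z_def by simp
    then have "v = val z + x"
      using t y unfolding expansions_def by simp
    then show "v \<in> cantor_set n D \<inter> translate (cantor_set n D) x"
      using D y unfolding cantor_set_eq digit_values_def translate_def by blast
  }
qed

text \<open>With a single expansion the intersection allows independent choices at each place. Its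
  infimum is attained by the least digits \<open>m\<close>, and subtracting it acts place by
  place.\<close>

lemma translate_inter_unique:
  assumes "expansions x = {t}"
  shows "translate_inter n D x = digit_values (\<lambda>k. overlap_digits (t k))"
proof -
  define A where "A = digit_values (\<lambda>k. overlap (t k))"
  define m where "m k = Min (overlap (t k))" for k
  have "\<forall>k. t k \<in> \<Delta>"
    using assms unfolding expansions_def by blast
  then have m: "m k \<in> overlap (t k)" for k
    unfolding m_def by (simp add: Min_overlap)
  have b: "\<bar>y k\<bar> \<le> int n - 1" if "\<And>k. y k \<in> overlap (t k)" for y k
    using overlap_bound[OF that[of k]] by linarith
  have "val m \<le> v" if "v \<in> A" for v
  proof -
    from that obtain y where "\<And>k. y k \<in> overlap (t k)" "v = val y"
      unfolding A_def digit_values_def by blast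
    then show ?thesis
      using val_mono[of m "int n - 1" y "int n - 1"] b[where y = m] b[where y = y] m finite_overlap
      by (simp add: m_def)
  qed
  moreover have "val m \<in> A"
    unfolding A_def digit_values_def using m by blast
  ultimately have Inf: "Inf A = val m" and "A \<noteq> {}"
    by (auto intro: cInf_eq_minimum)
  have "translate_inter n D x = (\<lambda>v. v - val m) ` A"
    using \<open>A \<noteq> {}\<close> Inf unfolding translate_inter_def cantor_inter_translate assms A_def by simp
  also have "\<dots> = digit_values (\<lambda>k. overlap_digits (t k))"
  proof (intro equalityI subsetI)
    fix v assume "v \<in> (\<lambda>v. v - val m) ` A"
    then obtain y where y: "\<And>k. y k \<in> overlap (t k)" "v = val y - val m"
      unfolding A_def digit_values_def by blast
    then have "v = val (\<lambda>k. y k - m k)"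
      using val_diff[of y _ m, OF b[where y = y, OF y(1)] b[where y = m, OF m]] by simp
    moreover have "y k - m k \<in> overlap_digits (t k)" for k
      using y unfolding overlap_digits_def m_def by blast
    ultimately show "v \<in> digit_values (\<lambda>k. overlap_digits (t k))"
      unfolding digit_values_def by blast
  next
    fix v assume "v \<in> digit_values (\<lambda>k. overlap_digits (t k))"
    then obtain e where e: "\<forall>k. e k \<in> overlap_digits (t k)" "v = val e"
      unfolding digit_values_def by blast
    define y where "y k = e k + m k" for k
    have y: "y k \<in> overlap (t k)" for k
    proof -
      obtain d where "d \<in> overlap (t k)" "e k = d - m k"
        using e unfolding overlap_digits_def m_def by blast
      then show ?thesis
        unfolding y_def by simp
    qed
    have "v = val y - val m"
      using val_diff[of y _ m, OF b[where y = y, OF y] b[where y = m, OF m]] e unfolding y_def by simp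
    then show "v \<in> (\<lambda>v. v - val m) ` A"
      using y unfolding A_def digit_values_def by blast
  qed
  finally show ?thesis .
qed

text \<open>At the first difference \<open>j\<close> of \<open>s\<close> and \<open>t\<close>, every
  expansion \<open>u\<close> disagrees with one of them. Its first difference from that one is at
  \<open>j\<close> or earlier, so \<open>u\<close> is extreme after \<open>j\<close>; hence one
  bound serves all \<open>u\<close>.\<close>

lemma several_expansions:
  assumes "s \<in> expansions x" "t \<in> expansions x" "s \<noteq> t"
  obtains j where "\<forall>u\<in>expansions x. \<exists>c\<in>{1, -1}. \<forall>k\<ge>j. u k = c * (int n - 1)"
proof -
  have st: "\<And>k. s k \<in> \<Delta>" "\<And>k. t k \<in> \<Delta>" "val s = val t"
    using assms unfolding expansions_def by auto
  obtain j c where c: "c = 1 \<or> c = -1" and j: "s j \<noteq> t j" "\<forall>i<j. s i = t i"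
    and "\<forall>k>j. s k = c * (int n - 1)" "\<forall>k>j. t k = - c * (int n - 1)"
    by (rule extreme_tails[OF st assms(3)])
  have tail: "\<exists>c\<in>{1, -1}. \<forall>k\<ge>Suc j. u k = c * (int n - 1)"
    if "u \<in> expansions x" "v \<in> {s, t}" "\<exists>k\<le>j. u k \<noteq> v k" for u v
  proof -
    have uv: "\<And>k. u k \<in> \<Delta>" "\<And>k. v k \<in> \<Delta>" "val u = val v" "u \<noteq> v"
      using that assms(1,2) unfolding expansions_def by auto
    obtain i d where d: "d = 1 \<or> d = -1" and i: "u i \<noteq> v i" "\<forall>k<i. u k = v k"
      and u: "\<forall>k>i. u k = d * (int n - 1)" "\<forall>k>i. v k = - d * (int n - 1)"
      by (rule extreme_tails[OF uv])
    have "i \<le> j"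
      using that(3) i(2) by (meson le_less_trans not_le)
    then show ?thesis
      using u(1) d by (intro bexI[of _ d]) auto
  qed
  have "\<exists>c\<in>{1, -1}. \<forall>k\<ge>Suc j. u k = c * (int n - 1)" if "u \<in> expansions x" for u
  proof (cases "u j = s j")
    case True
    then show ?thesis
      using j(1) by (intro tail[OF that, of t]) auto
  next
    case False
    then show ?thesis
      by (intro tail[OF that, of s]) auto
  qed
  then show thesis
    by (intro that ballI)
qed

text \<open>After place \<open>j\<close> an expansion is constantly \<open>n - 1\<close> or
  \<open>- (n - 1)\<close>, which forces the digits of \<open>v\<close> there to be all
  \<open>n - 1\<close> or all 0. So \<open>n ^ j * v\<close> is an integer between 0 and
  \<open>n ^ j\<close>.\<close>

lemma several_expansions_finite:
  assumes "s \<in> expansions x" "t \<in> expansions x" "s \<noteq> t"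
  shows "x \<in> \<rat>" "finite (cantor_set n D \<inter> translate (cantor_set n D) x)"
proof -
  obtain j where j: "\<forall>u\<in>expansions x. \<exists>c\<in>{1, -1}. \<forall>k\<ge>j. u k = c * (int n - 1)"
    by (rule several_expansions[OF assms])
  have "\<And>k. \<bar>s k\<bar> \<le> int n - 1"
    using assms(1) \<Delta>_bound unfolding expansions_def by blast
  then show "x \<in> \<rat>"
    using j[rule_format, OF assms(1)] val_const_tail_Ints[of s] Rats_of_power_mult_Ints assms(1)
    unfolding expansions_def by blast
  have "v \<in> (\<lambda>i. real_of_int i / real n ^ j) ` {0..int n ^ j}"
    if "v \<in> cantor_set n D \<inter> translate (cantor_set n D) x" for v
  proof -
    from that obtain u y where u: "u \<in> expansions x" and y: "\<And>k. y k \<in> overlap (u k)" "v = val y"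
      unfolding cantor_inter_translate digit_values_def by blast
    have b: "\<bar>y k\<bar> \<le> int n - 1" "0 \<le> y k" "y k \<le> 1 * (int n - 1)" for k
      using overlap_bound[OF y(1), of k] by simp_all
    obtain c where "c \<in> {1, -1}" "\<forall>k\<ge>j. u k = c * (int n - 1)"
      using j[rule_format, OF u] by blast
    then have "\<exists>d. \<forall>k\<ge>j. y k = d * (int n - 1)"
    proof (elim insertE; clarify?)
      assume "\<forall>k\<ge>j. u k = 1 * (int n - 1)"
      then show ?thesis
        using y(1) overlap_extreme(1) by (intro exI[of _ 1]) (metis mult_1 singletonD subsetD)
    next
      assume "\<forall>k\<ge>j. u k = -1 * (int n - 1)"
      then show ?thesis
        using y(1) overlap_extreme(2)
        by (intro exI[of _ 0]) (metis mult_minus1 mult_zero_left singletonD subsetD)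
    qed
    then have "real n ^ j * v \<in> \<int>"
      using val_const_tail_Ints[of y, OF b(1)] y(2) by blast
    then obtain i where i: "real n ^ j * v = real_of_int i"
      by (auto elim: Ints_cases)
    have "0 \<le> v" "v \<le> 1"
      using val_nonneg[OF b(1,2)] val_le[OF b(1,3)] y(2) by auto
    then have "0 \<le> real_of_int i" "real_of_int i \<le> real_of_int (int n ^ j)"
      using n_pos unfolding i[symmetric] by (auto intro: mult_left_le)
    then have "i \<in> {0..int n ^ j}"
      unfolding of_int_le_iff by simp
    moreover have "v = real_of_int i / real n ^ j"
      using i n_pos by (simp add: field_simps)
    ultimately show ?thesis
      by blast
  qed
  then show "finite (cantor_set n D \<inter> translate (cantor_set n D) x)"
    by (meson finite_atLeastAtMost_int finite_imageI finite_subset subsetI)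
qed

end

section \<open>Periodicity and self-similarity\<close>

text \<open>Along each residue class modulo \<open>q\<close> the sets grow inside a finite set and
  must stabilise. The sum \<open>f\<close> of cardinalities over a window of length \<open>q\<close>
  handles all classes at once: from \<open>N\<close> on it is increasing and bounded, and after its
  maximum at \<open>M\<close> no inclusion can be strict.\<close>

lemma eventually_periodic_of_subset_shift:
  fixes E :: "nat \<Rightarrow> 'a set"
  assumes "\<And>k. N \<le> k \<Longrightarrow> E k \<subseteq> E (k + q)" and "finite S" "\<And>k. E k \<subseteq> S"
  obtains M where "\<forall>k\<ge>M. E (k + q) = E k"
proof -
  define f where "f k = (\<Sum>i<q. card (E (k + i)))" for k
  have fin: "finite (E k)" for k
    using finite_subset[OF assms(3,2)] .
  have step_eq: "f (Suc k) + card (E k) = f k + card (E (k + q))" for k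
    unfolding f_def using sum.lessThan_Suc_shift[of "\<lambda>i. card (E (k + i))" q] by simp
  have mono: "card (E k) \<le> card (E (k + q))" if "N \<le> k" for k
    using card_mono[OF fin assms(1)[OF that]] .
  have bound: "f k \<le> q * card S" for k
    unfolding f_def using sum_bounded_above[of "{..<q}" "\<lambda>i. card (E (k + i))" "card S"]
      card_mono[OF assms(2,3)] by simp
  have "\<exists>M. N \<le> M \<and> (\<forall>k. N \<le> k \<longrightarrow> f k \<le> f M)"
    using bound by (intro ex_has_greatest_nat[of _ N _ "Suc (q * card S)"]) (simp_all add: less_Suc_eq_le)
  then obtain M where M: "N \<le> M" "\<And>k. N \<le> k \<Longrightarrow> f k \<le> f M"
    by auto
  have above: "f M \<le> f k" if "M \<le> k" for k
    using that
  proof (induction k rule: dec_induct)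
    case (step k)
    then show ?case
      using step_eq[of k] mono[of k] M(1) by simp
  qed simp
  have "E (k + q) = E k" if "M \<le> k" for k
  proof -
    have "card (E (k + q)) \<le> card (E k)"
      using step_eq[of k] above[OF that] M(2)[of "Suc k"] M(1) that by simp
    then show ?thesis
      using card_seteq[OF fin assms(1)] M(1) that by (metis le_trans)
  qed
  then show thesis
    by (intro that) blast
qed

context sparse_radix
begin

text \<open>What is needed of the digit sets of \<open>C(x)\<close>: nonnegative digits from
  \<Delta> make digit sequences unique, and the digit 0 allows any place to be cleared.\<close>

definition admissible :: "(nat \<Rightarrow> int set) \<Rightarrow> bool" where
  "admissible E \<longleftrightarrow> (\<forall>k. 0 \<in> E k \<and> E k \<subseteq> {e \<in> \<Delta>. 0 \<le> e})"

lemma admissible_overlap_digits: "(\<And>k. t k \<in> \<Delta>) \<Longrightarrow> admissible (\<lambda>k. overlap_digits (t k))"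
  unfolding admissible_def
  using overlap_digits_in_\<Delta> overlap_digits_nonneg zero_in_overlap_digits by fast

lemma admissible_bound:
  assumes "admissible E" "e \<in> E k"
  shows "0 \<le> e" "e \<le> int n - 1" "\<bar>e\<bar> \<le> int n - 1" "e \<in> \<Delta>"
proof -
  show "0 \<le> e" "e \<in> \<Delta>"
    using assms unfolding admissible_def by blast+
  then show "\<bar>e\<bar> \<le> int n - 1" "e \<le> int n - 1"
    using \<Delta>_bound[of e] by auto
qed

lemma admissible_finite: "admissible E \<Longrightarrow> finite (E k)"
  using admissible_bound(1,2) by (intro finite_subset[of "E k" "{0..int n - 1}"]) auto

lemma val_digits_unique:
  assumes "admissible E" "admissible E'" "\<And>k. e k \<in> E k" "\<And>k. e' k \<in> E' k" "val e = val e'"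
  shows "e = e'"
  using assms admissible_bound(1,4) by (intro nonneg_expansion_unique[of e e']) blast+

text \<open>As 0 is in \<Delta>, sparseness makes every nonzero digit at least 2. At a place
  \<open>k < N\<close> it would contribute \<open>2 / n ^ Suc k\<close>, which exceeds
  \<open>1 / n ^ N\<close>, whereas digits from place \<open>N\<close> on add up to at most
  \<open>1 / n ^ N\<close>.\<close>

lemma digit_values_initial_segment:
  assumes "admissible E"
  shows "digit_values E \<inter> {0..1 / real n ^ N} = digit_values (\<lambda>k. if k < N then {0} else E k)"
proof (intro equalityI subsetI)
  fix v assume "v \<in> digit_values E \<inter> {0..1 / real n ^ N}"
  then obtain e where e: "\<And>k. e k \<in> E k" "v = val e" and v: "v \<le> 1 / real n ^ N"
    unfolding digit_values_def by auto
  have b: "0 \<le> e k" "\<bar>e k\<bar> \<le> int n - 1" "e k \<in> \<Delta>" for k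
    using admissible_bound[OF assms e(1)[of k]] by simp_all
  have "e k = 0" if "k < N" for k
  proof (rule ccontr)
    assume "e k \<noteq> 0"
    then have "2 \<le> e k"
      using \<Delta>_sparse[OF zero_in_\<Delta> b(3)[of k]] b(1)[of k] by simp
    then have "2 / real n ^ Suc k \<le> real_of_int (e k) / real n ^ Suc k"
      using n_pos by (intro divide_right_mono) auto
    also have "\<dots> \<le> val e"
      unfolding val_single[symmetric]
    proof (rule val_mono[of _ "\<bar>e k\<bar>" e "int n - 1"])
      show "\<bar>if i = k then e k else 0\<bar> \<le> \<bar>e k\<bar>" for i
        by simp
    qed (use b in auto)
    also have "val e \<le> 1 / real n ^ N"
      using v e(2) by simp
    also have "\<dots> \<le> 1 / real n ^ Suc k"
      using n_gt_1 that by (intro divide_left_mono power_increasing) auto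
    finally show False
      using n_pos by (simp add: divide_le_cancel)
  qed
  then have "\<forall>k. e k \<in> (if k < N then {0} else E k)"
    using e(1) by simp
  then show "v \<in> digit_values (\<lambda>k. if k < N then {0} else E k)"
    using e(2) unfolding digit_values_def by blast
next
  fix v assume "v \<in> digit_values (\<lambda>k. if k < N then {0} else E k)"
  then obtain e where e: "\<And>k. e k \<in> (if k < N then {0} else E k)" "v = val e"
    unfolding digit_values_def by blast
  have eE: "e k \<in> E k" for k
    using e(1)[of k] assms unfolding admissible_def by (auto split: if_splits)
  have b: "0 \<le> e k" "\<bar>e k\<bar> \<le> int n - 1" "e k \<le> 1 * (int n - 1)" for k
    using admissible_bound[OF assms eE[of k]] by simp_all
  have "e k = 0" if "k < N" for k
    using e(1)[of k] that by simp
  then have "val e = val (\<lambda>k. e (k + N)) / real n ^ N"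
    using val_eq_tail[of e "int n - 1" N] b by blast
  moreover have "val (\<lambda>k. e (k + N)) \<le> 1"
    using val_le[of "\<lambda>k. e (k + N)" "int n - 1" 1] b by simp
  ultimately have "v \<le> 1 / real n ^ N"
    using e(2) n_pos by (simp add: divide_right_mono)
  moreover have "0 \<le> v"
    using val_nonneg[of e] b e(2) by blast
  ultimately show "v \<in> digit_values E \<inter> {0..1 / real n ^ N}"
    using eE e(2) unfolding digit_values_def by auto
qed

section \<open>Self-similarity from periodic digit sets\<close>

lemma val_shift:
  assumes "\<And>k. \<bar>a k\<bar> \<le> A"
  shows "val (\<lambda>k. if k < p then 0 else a (k - p)) = val a / real n ^ p"
proof -
  have "\<bar>if k < p then 0 else a (k - p)\<bar> \<le> A" for k
    using assms[of "k - p"] abs_ge_zero order_trans by auto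
  then show ?thesis
    using val_eq_tail[of "\<lambda>k. if k < p then 0 else a (k - p)" A p] by simp
qed

lemma powi_minus_nat: "real n powi (- int q) * y = y / real n ^ q"
  by (simp add: power_int_minus field_simps)

definition radix_self_similar :: "real set \<Rightarrow> bool" where
  "radix_self_similar T \<longleftrightarrow>
     (\<exists>F. (\<forall>f\<in>F. \<exists>q\<ge>1. \<exists>b. f = (\<lambda>y. real n powi (- int q) * y + b)) \<and>
          self_similar_set_generated_by F T)"

lemma contracting_similarity_radix:
  assumes "1 \<le> q"
  shows "contracting_similarity (\<lambda>y. real n powi (- int q) * y + b)"
proof -
  have "1 < real n ^ q"
    using n_gt_1 assms by (simp add: one_less_power)
  then have "0 < real n powi (- int q)" "real n powi (- int q) < 1"
    using n_pos by (simp_all add: power_int_minus inverse_less_1_iff)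
  then have "0 < \<bar>real n powi (- int q)\<bar>" "\<bar>real n powi (- int q)\<bar> < 1"
    by simp_all
  then show ?thesis
    unfolding contracting_similarity_def by blast
qed

text \<open>This covers a finite \<open>C(x)\<close>, of which only 0 remains near 0.\<close>

lemma radix_self_similar_singleton: "radix_self_similar {0}"
  unfolding radix_self_similar_def self_similar_set_generated_by_def
  using contracting_similarity_radix[of 1 0]
  by (intro exI[of _ "{\<lambda>y. real n powi (- int 1) * y + 0}"]) force

text \<open>The places \<open>N\<close> to \<open>N + p - 1\<close> form a block with finitely many
  fillings \<open>b\<close>. By periodicity what follows is a point of the same set moved by
  \<open>p\<close> places, so each filling gives one map with ratio \<open>n ^ (-p)\<close> and
  translation part \<open>val b\<close>.\<close>

lemma radix_self_similar_periodic:
  assumes "admissible E" "1 \<le> p" "\<forall>k\<ge>N. E (k + p) = E k"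
  shows "radix_self_similar (digit_values E \<inter> {0..1 / real n ^ N})"
proof -
  define E' where "E' k = (if k < N then {0} else E k)" for k
  define block where "block k = (if N \<le> k \<and> k < N + p then E k else {0})" for k
  define B where "B = {b. \<forall>k. b k \<in> block k}"
  define F where "F = (\<lambda>b y. real n powi (- int p) * y + val b) ` B"
  have adm: "admissible E'" "admissible block"
    using assms(1) zero_in_\<Delta> unfolding admissible_def E'_def block_def by auto
  have "finite B"
  proof (rule finite_subset)
    show "B \<subseteq> {b. \<forall>k. (k \<in> {N..<N + p} \<longrightarrow> b k \<in> (\<Union>k\<in>{N..<N + p}. E k)) \<and> (k \<notin> {N..<N + p} \<longrightarrow> b k = 0)}"
    proof (intro subsetI CollectI allI conjI impI)
      fix b k assume b: "b \<in> B"
      show "b k \<in> (\<Union>k\<in>{N..<N + p}. E k)" if "k \<in> {N..<N + p}"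
      proof -
        have "b k \<in> block k"
          using b unfolding B_def by blast
        then have "b k \<in> E k"
          using that unfolding block_def by simp
        then show ?thesis
          using that by blast
      qed
      show "b k = 0" if "k \<notin> {N..<N + p}"
      proof -
        have "b k \<in> block k"
          using b unfolding B_def by blast
        then show ?thesis
          using that unfolding block_def by (auto split: if_splits)
      qed
    qed
    show "finite {b. \<forall>k. (k \<in> {N..<N + p} \<longrightarrow> b k \<in> (\<Union>k\<in>{N..<N + p}. E k)) \<and> (k \<notin> {N..<N + p} \<longrightarrow> b k = (0::int))}"
      using admissible_finite[OF assms(1)] by (intro finite_set_of_finite_funs) auto
  qed
  have sum: "val (\<lambda>k. b k + (if k < p then 0 else u (k - p))) = real n powi (- int p) * val u + val b"
    if "\<And>k. b k \<in> block k" "\<And>k. u k \<in> E' k" for b u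
  proof -
    have b: "\<bar>b k\<bar> \<le> int n - 1" and u: "\<bar>u k\<bar> \<le> int n - 1" for k
      using admissible_bound(3)[OF adm(2) that(1)[of k]] admissible_bound(3)[OF adm(1) that(2)[of k]] .
    have "\<bar>if k < p then 0 else u (k - p)\<bar> \<le> int n - 1" for k
      using u[of "k - p"] two_le_n by simp
    then show ?thesis
      using val_add[of b "int n - 1" "\<lambda>k. if k < p then 0 else u (k - p)" "int n - 1"] b
        val_shift[of u "int n - 1" p] u by (simp add: powi_minus_nat)
  qed
  have "digit_values E' = (\<Union>f\<in>F. f ` digit_values E')"
  proof (intro equalityI subsetI)
    fix v assume "v \<in> digit_values E'"
    then obtain e where e: "\<And>k. e k \<in> E' k" "v = val e"
      unfolding digit_values_def by blast
    \<comment> \<open>\<open>b\<close> keeps the block; \<open>u\<close> holds the later digits,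
      moved back by \<open>p\<close> places.\<close>
    define b where "b k = (if k < N + p then e k else 0)" for k
    define u where "u k = (if k < N then 0 else e (k + p))" for k
    have b: "b k \<in> block k" for k
      using e(1)[of k] unfolding b_def block_def E'_def by (auto split: if_splits)
    have u: "u k \<in> E' k" for k
      using e(1)[of "k + p"] assms(3) unfolding u_def E'_def by (auto split: if_splits)
    have "e k = b k + (if k < p then 0 else u (k - p))" for k
      unfolding b_def u_def by auto
    then have "e = (\<lambda>k. b k + (if k < p then 0 else u (k - p)))"
      by blast
    then have "v = real n powi (- int p) * val u + val b"
      using sum[of b u, OF b u] e(2) by simp
    then show "v \<in> (\<Union>f\<in>F. f ` digit_values E')"
      using b u unfolding F_def B_def digit_values_def by blast
  next
    fix v assume "v \<in> (\<Union>f\<in>F. f ` digit_values E')"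
    then obtain b u where b: "\<And>k. b k \<in> block k" and u: "\<And>k. u k \<in> E' k"
      and v: "v = real n powi (- int p) * val u + val b"
      unfolding F_def B_def digit_values_def by blast
    \<comment> \<open>At most one summand is nonzero: below \<open>N + p\<close> the shifted
      \<open>u\<close> vanishes, from there on \<open>b\<close> does.\<close>
    have "b k + (if k < p then 0 else u (k - p)) \<in> E' k" for k
    proof (cases "k < N + p")
      case True
      then have "k < p \<or> u (k - p) = 0"
        using u[of "k - p"] unfolding E'_def by (auto split: if_splits)
      then show ?thesis
        using b[of k] True unfolding block_def E'_def by (auto split: if_splits)
    next
      case False
      then have "E k = E (k - p)"
        using assms(3)[rule_format, of "k - p"] by simp
      then show ?thesis
        using b[of k] u[of "k - p"] False unfolding block_def E'_def by (auto split: if_splits)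
    qed
    then show "v \<in> digit_values E'"
      unfolding v sum[of b u, OF b u, symmetric] by (rule digit_valuesI)
  qed
  moreover have "compact (digit_values E')"
    using admissible_finite[OF adm(1)] admissible_bound(3)[OF adm(1)] by (rule compact_digit_values)
  moreover have "val (\<lambda>_. 0) \<in> digit_values E'"
    using adm(1) unfolding admissible_def by (intro digit_valuesI) simp
  then have "digit_values E' \<noteq> {}"
    by auto
  moreover have "finite F"
    unfolding F_def using \<open>finite B\<close> by simp
  moreover have "\<forall>f\<in>F. contracting_similarity f"
    unfolding F_def using contracting_similarity_radix[OF assms(2)] by simp
  ultimately have "self_similar_set_generated_by F (digit_values E')"
    unfolding self_similar_set_generated_by_def by simp
  moreover have "\<forall>f\<in>F. \<exists>q\<ge>1. \<exists>b. f = (\<lambda>y. real n powi (- int q) * y + b)"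
    unfolding F_def using assms(2) by fast
  ultimately have "radix_self_similar (digit_values E')"
    unfolding radix_self_similar_def by (intro exI conjI)
  then show ?thesis
    using digit_values_initial_segment[OF assms(1), of N] unfolding E'_def by simp
qed

text \<open>A map of the system that hits 0 must fix it, so its ratio \<open>n\<^sup>-\<^sup>q\<close> maps the set
  into itself; on digits this shifts positions by \<open>q\<close>.\<close>

lemma subset_shift_of_radix_self_similar:
  assumes "admissible E" "0 < \<epsilon>" "radix_self_similar (digit_values E \<inter> {0..\<epsilon>})"
  obtains q N where "1 \<le> q" "\<forall>k\<ge>N. E k \<subseteq> E (k + q)"
proof -
  define T where "T = digit_values E \<inter> {0..\<epsilon>}"
  obtain F where F: "\<And>f. f \<in> F \<Longrightarrow> \<exists>q\<ge>1. \<exists>b. f = (\<lambda>y. real n powi (- int q) * y + b)"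
    and T: "T = (\<Union>f\<in>F. f ` T)"
    using assms(3) unfolding radix_self_similar_def self_similar_set_generated_by_def T_def by metis
  have E0: "0 \<in> E k" for k
    using assms(1) unfolding admissible_def by blast
  have "val (\<lambda>_. 0) = 0"
    using val_const[of 0] by simp
  then have "0 \<in> digit_values E"
    using digit_valuesI[of "\<lambda>_. 0" E] E0 by simp
  then have "0 \<in> T"
    using assms(2) unfolding T_def by simp
  then obtain f y where f: "f \<in> F" "y \<in> T" "f y = 0"
    using T by (metis UN_E imageE)
  then obtain q b where q: "1 \<le> q" and fb: "f = (\<lambda>y. real n powi (- int q) * y + b)"
    using F by blast
  have "f 0 \<in> T"
    using f(1) \<open>0 \<in> T\<close> T by blast
  then have "0 \<le> b"
    unfolding fb T_def by simp
  moreover have "0 \<le> real n powi (- int q) * y"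
    using f(2) unfolding T_def by simp
  ultimately have "b = 0"
    using f(3) unfolding fb by linarith
  then have scale: "v / real n ^ q \<in> T" if "v \<in> T" for v
    using f(1) that T powi_minus_nat[of q] unfolding fb by auto
  obtain N where "(1 / real n) ^ N < \<epsilon>"
    using real_arch_pow_inv[of \<epsilon> "1 / real n"] assms(2) n_gt_1 by auto
  then have N: "1 / real n ^ N \<le> \<epsilon>"
    by (simp add: power_one_over)
  \<comment> \<open>The test point has the single digit \<open>e\<close> at place \<open>k\<close>;
    for \<open>k \<ge> N\<close> it is small enough to lie in \<open>T\<close>. Division by
    \<open>n ^ q\<close> moves its digit to place \<open>k + q\<close>.\<close>
  have "e \<in> E (k + q)" if k: "N \<le> k" and e: "e \<in> E k" for k e
  proof -
    have digits: "(if i = k then e else 0) \<in> E i" for i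
      using e E0 by simp
    have "e \<le> int n - 1" "0 \<le> e"
      using admissible_bound[OF assms(1) e] by simp_all
    then have "real_of_int e \<le> real n"
      by linarith
    then have "real_of_int e / real n ^ Suc k \<le> real n / real n ^ Suc k"
      using n_pos by (intro divide_right_mono) auto
    also have "\<dots> = 1 / real n ^ k"
      using n_pos by simp
    also have "\<dots> \<le> 1 / real n ^ N"
      using k n_gt_1 by (intro divide_left_mono power_increasing) auto
    finally have "real_of_int e / real n ^ Suc k \<le> \<epsilon>"
      using N by linarith
    moreover have "real_of_int e / real n ^ Suc k \<in> digit_values E"
      unfolding val_single[symmetric] using digits by (rule digit_valuesI)
    ultimately have "real_of_int e / real n ^ Suc k \<in> T"
      using \<open>0 \<le> e\<close> unfolding T_def by simp
    then have "real_of_int e / real n ^ Suc k / real n ^ q \<in> digit_values E"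
      using scale unfolding T_def by blast
    then obtain e' where e': "\<And>k. e' k \<in> E k" "val e' = real_of_int e / real n ^ Suc k / real n ^ q"
      unfolding digit_values_def by fastforce
    have "val (\<lambda>i. if i = k + q then e else 0) = val e'"
      unfolding e'(2) val_single by (simp add: power_add)
    \<comment> \<open>An auxiliary family for the moved digit, as \<open>e \<in> E (k + q)\<close>
      is still to be shown.\<close>
    moreover have "admissible (\<lambda>i. {0, e})"
      using admissible_bound[OF assms(1) e] zero_in_\<Delta> unfolding admissible_def by simp
    ultimately have "(\<lambda>i. if i = k + q then e else 0) = e'"
      using e'(1) assms(1) by (intro val_digits_unique[of "\<lambda>i. {0, e}" E]) auto
    from fun_cong[OF this, of "k + q"] have "e' (k + q) = e"
      by simp
    then show ?thesis
      using e'(1) by blast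
  qed
  then show thesis
    using q by (intro that[of q N]) auto
qed

text \<open>With \<open>x = a / b\<close>, the value \<open>r j\<close> of the digits from place
  \<open>j\<close> on differs from \<open>n ^ j * x\<close> by an integer. It is thus a multiple of
  \<open>1 / b\<close> in \<open>[-1,1]\<close>, and two of these values coincide.\<close>

lemma rational_expansion_eventually_periodic:
  assumes "t \<in> expansions x" "x \<in> \<rat>"
  obtains p N where "1 \<le> p" "\<forall>k\<ge>N. t (k + p) = t k"
proof -
  define r where "r j = val (\<lambda>k. t (k + j))" for j
  have t: "t k \<in> \<Delta>" "\<bar>t k\<bar> \<le> 1 * (int n - 1)" for k
    using assms(1) \<Delta>_bound unfolding expansions_def by auto
  obtain a b :: int where ab: "b > 0" "x = of_int a / of_int b"
    using assms(2) by (metis Rats_cases')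
  have "r j \<in> (\<lambda>i. real_of_int i / real_of_int b) ` {-b..b}" for j
  proof -
    have "real n ^ j * x = real n ^ j * (\<Sum>k<j. real_of_int (t k) / real n ^ Suc k) + r j"
    proof -
      have "x = (\<Sum>k<j. real_of_int (t k) / real n ^ Suc k) + r j / real n ^ j"
        using val_split[of t _ j, OF t(2)] assms(1) unfolding expansions_def r_def by blast
      then show ?thesis
        using n_pos by (simp add: distrib_left)
    qed
    then have eq: "r j = real n ^ j * x - real n ^ j * (\<Sum>k<j. real_of_int (t k) / real n ^ Suc k)"
      by linarith
    have "real_of_int b * r j = real n ^ j * (real_of_int b * x) -
        real_of_int b * (real n ^ j * (\<Sum>k<j. real_of_int (t k) / real n ^ Suc k))"
      unfolding eq by (simp only: right_diff_distrib mult.left_commute)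
    moreover have "real_of_int b * x \<in> \<int>"
      using ab by simp
    ultimately have "real_of_int b * r j \<in> \<int>"
      using Ints_diff[OF Ints_mult[OF Ints_power[OF Ints_of_nat]] Ints_mult[OF Ints_of_int initial_sum_Ints]]
      by simp
    then obtain i where i: "real_of_int b * r j = real_of_int i"
      by (rule Ints_cases)
    have "\<bar>r j\<bar> \<le> 1"
      unfolding r_def using abs_val_le[of "\<lambda>k. t (k + j)" 1] t(2) by simp
    then have "\<bar>real_of_int i\<bar> \<le> real_of_int b"
      unfolding i[symmetric] using ab(1) by (simp add: abs_mult mult_left_le)
    then have "i \<in> {-b..b}"
      by auto
    moreover have "r j = real_of_int i / real_of_int b"
      using i ab(1) by (simp add: field_simps)
    ultimately show ?thesis
      by blast
  qed
  then have "finite (range r)"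
    by (meson finite_atLeastAtMost_int finite_imageI finite_subset image_subsetI)
  then have "\<not> inj r"
    using finite_imageD[of r UNIV] by auto
  then obtain i j where ij: "i < j" "r i = r j"
    unfolding inj_def by (metis linorder_neqE_nat)
  show thesis
  \<comment> \<open>Equal remainders need not have equal digits. If the digits differ, both tails
    are extreme and \<open>t\<close> is eventually constant.\<close>
  proof (cases "(\<lambda>k. t (k + i)) = (\<lambda>k. t (k + j))")
    case True
    have "t (k + (j - i)) = t k" if "i \<le> k" for k
      using fun_cong[OF True, of "k - i"] ij(1) that by simp
    then show thesis
      using ij(1) by (intro that[of "j - i" i]) auto
  next
    case False
    show thesis
    proof (rule extreme_tails[OF t(1) t(1) ij(2)[unfolded r_def] False])
      fix l c assume l: "\<forall>k>l. t (k + i) = c * (int n - 1)"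
      have "t k = c * (int n - 1)" if "Suc l + i \<le> k" for k
        using l[rule_format, of "k - i"] that by simp
      then show thesis
        by (intro that[of 1 "Suc l + i"]) auto
    qed
  qed
qed

text \<open>A unique expansion is eventually periodic, and \<epsilon> is taken from the start
  \<open>N\<close> of the period. Otherwise \<open>C(x)\<close> is finite and a small \<epsilon>
  isolates 0.\<close>

lemma rational_imp_radix_self_similar:
  assumes "x \<in> \<rat>" "translate_inter n D x \<noteq> {}"
  obtains \<epsilon> where "0 < \<epsilon>" "radix_self_similar (translate_inter n D x \<inter> {0..\<epsilon>})"
proof -
  define A where "A = cantor_set n D \<inter> translate (cantor_set n D) x"
  have "A \<noteq> {}"
    using assms(2) unfolding translate_inter_def A_def by (auto simp: Let_def)
  then obtain t where t: "t \<in> expansions x"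
    unfolding A_def cantor_inter_translate by blast
  show thesis
  proof (cases "expansions x = {t}")
    case True
    obtain p N where p: "1 \<le> p" "\<forall>k\<ge>N. t (k + p) = t k"
      using rational_expansion_eventually_periodic[OF t assms(1)] .
    have "admissible (\<lambda>k. overlap_digits (t k))"
      using t unfolding expansions_def by (intro admissible_overlap_digits) blast
    then have "radix_self_similar (digit_values (\<lambda>k. overlap_digits (t k)) \<inter> {0..1 / real n ^ N})"
      using p by (intro radix_self_similar_periodic) auto
    then show thesis
      unfolding translate_inter_unique[OF True, symmetric] using n_pos by (intro that[of "1 / real n ^ N"]) auto
  next
    case False
    then obtain s where s: "s \<in> expansions x" "s \<noteq> t"
      using t by blast
    have "finite A"
      unfolding A_def using several_expansions_finite(2)[OF s(1) t s(2)] .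
    define T where "T = translate_inter n D x"
    have T_eq: "T = (\<lambda>y. y - Inf A) ` A"
      using \<open>A \<noteq> {}\<close> unfolding T_def translate_inter_def A_def by (simp add: Let_def)
    have "finite T" "0 \<in> T" "\<And>y. y \<in> T \<Longrightarrow> 0 \<le> y"
      unfolding T_eq using \<open>finite A\<close> \<open>A \<noteq> {}\<close> Min_in[of A]
      by (auto simp: cInf_eq_Min intro!: image_eqI[of _ _ "Min A"])
    \<comment> \<open>The inserted 1 keeps the minimum defined when 0 is the only point of
      \<open>T\<close>.\<close>
    define \<epsilon> where "\<epsilon> = Min (insert 1 (T - {0})) / 2"
    have fin: "finite (insert 1 (T - {0}))"
      using \<open>finite T\<close> by simp
    have pos: "0 < Min (insert 1 (T - {0}))"
      using \<open>\<And>y. y \<in> T \<Longrightarrow> 0 \<le> y\<close> fin by (subst Min_gr_iff) (auto simp: less_le)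
    have "T \<inter> {0..\<epsilon>} = {0}"
    proof -
      have "y = 0" if "y \<in> T" "y \<le> \<epsilon>" for y
      proof (rule ccontr)
        assume "y \<noteq> 0"
        then have "Min (insert 1 (T - {0})) \<le> y"
          using that(1) fin by (intro Min_le) auto
        then show False
          using that(2) pos unfolding \<epsilon>_def by linarith
      qed
      then show ?thesis
        using \<open>0 \<in> T\<close> pos unfolding \<epsilon>_def by auto
    qed
    then have "radix_self_similar (translate_inter n D x \<inter> {0..\<epsilon>})"
      using radix_self_similar_singleton unfolding T_def by simp
    moreover have "0 < \<epsilon>"
      using pos unfolding \<epsilon>_def by simp
    ultimately show thesis
      by (rule that[rotated])
  qed
qed

text \<open>The digits are given alternating signs, since an expansion of a number having a second
  one ends in digits that are all equal and nonzero.\<close>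

lemma rational_of_periodic_overlap_digits:
  assumes t: "\<And>k. t k \<in> \<Delta>" and "1 \<le> p"
    and per: "\<forall>k\<ge>N. overlap_digits (t (k + p)) = overlap_digits (t k)"
  obtains y where "y \<in> \<rat>" "0 \<le> y" "y \<le> 1"
    "translate_inter n D y = digit_values (\<lambda>k. overlap_digits (t k))"
proof -
  \<comment> \<open>Only the overlap digits of \<open>t\<close> are known to be periodic, not
    \<open>t\<close> itself. Folding every place back into the first period makes the digits repeat
    as well.\<close>
  define \<sigma> where "\<sigma> k = (if k < N then k else N + (k - N) mod p)" for k
  define u where "u k = (-1) ^ k * \<bar>t (\<sigma> k)\<bar>" for k
  have E_\<sigma>: "overlap_digits (t (\<sigma> k)) = overlap_digits (t k)" for k
  proof (cases "k < N")
    case False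
    have "overlap_digits (t (N + r + m * p)) = overlap_digits (t (N + r))" for r m
    proof (induction m)
      case (Suc m)
      then show ?case
        using per[rule_format, of "N + r + m * p"] by (simp add: ac_simps)
    qed simp
    from this[of "(k - N) mod p" "(k - N) div p"] show ?thesis
      using False unfolding \<sigma>_def by (simp add: add.assoc)
  qed (simp add: \<sigma>_def)
  \<comment> \<open>A global sign that makes the value nonnegative and leaves the overlap digits
    unchanged.\<close>
  define c :: int where "c = (if 0 \<le> val u then 1 else -1)"
  define w where "w k = c * u k" for k
  have c: "c = 1 \<or> c = -1"
    unfolding c_def by simp
  have w_cases: "w k = t (\<sigma> k) \<or> w k = - t (\<sigma> k)" for k
    using c unfolding w_def u_def by (cases "even k") (auto simp: abs_if)
  then have w: "w k \<in> \<Delta>" for k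
    using t[of "\<sigma> k"] uminus_in_\<Delta> by metis
  have wb: "\<bar>w k\<bar> \<le> 1 * (int n - 1)" for k
    using \<Delta>_bound[OF w[of k]] by simp
  have ub: "\<bar>u k\<bar> \<le> int n - 1" for k
    using wb[of k] c unfolding w_def by auto
  have "val w = \<bar>val u\<bar>"
    using val_uminus[of u, OF ub] unfolding w_def c_def by simp
  then have "0 \<le> val w" "val w \<le> 1"
    using abs_val_le[of w 1] wb by auto
  moreover have "val w \<in> \<rat>"
  proof (rule val_eventually_periodic_Rats[of w, OF wb])
    \<comment> \<open>The period is doubled so that the sign \<open>(-1) ^ k\<close> repeats too,
      even for odd \<open>p\<close>.\<close>
    show "0 < 2 * p"
      using \<open>1 \<le> p\<close> by simp
    fix k assume k: "N \<le> k"
    have "\<sigma> (k + 2 * p) = \<sigma> k"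
    proof -
      have "k + 2 * p - N = k - N + 2 * p"
        using k by simp
      then have "(k + 2 * p - N) mod p = (k - N) mod p"
        by (simp only: mod_mult_self1)
      then show ?thesis
        using k unfolding \<sigma>_def by simp
    qed
    then show "w (k + 2 * p) = w k"
      unfolding w_def u_def by (simp add: power_add power_mult)
  qed
  moreover have unique: "expansions (val w) = {w}"
  proof -
    have "s = w" if s: "\<And>k. s k \<in> \<Delta>" "val s = val w" for s
    proof (rule ccontr)
      assume "s \<noteq> w"
      show False
      proof (rule extreme_tails[of s w])
        fix j d assume d: "d = 1 \<or> d = -1" and tail: "\<forall>k>j. w k = - d * (int n - 1)"
        have "0 < w (Suc (Suc j)) * w (Suc j)"
          using d tail[rule_format, of "Suc j"] tail[rule_format, of "Suc (Suc j)"] two_le_n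
          by (auto simp: zero_less_mult_iff)
        moreover have "w (Suc (Suc j)) * w (Suc j) = - (\<bar>t (\<sigma> (Suc (Suc j)))\<bar> * \<bar>t (\<sigma> (Suc j))\<bar>)"
          using c unfolding w_def u_def by (cases "even j") auto
        moreover have "0 \<le> \<bar>t (\<sigma> (Suc (Suc j)))\<bar> * \<bar>t (\<sigma> (Suc j))\<bar>"
          by simp
        ultimately show False
          by linarith
      qed (use s w \<open>s \<noteq> w\<close> in auto)
    qed
    then show ?thesis
      using w unfolding expansions_def by auto
  qed
  moreover have "overlap_digits (w k) = overlap_digits (t k)" for k
    using w_cases[of k] overlap_digits_uminus[OF t[of "\<sigma> k"]] E_\<sigma>[of k] by auto
  then have "translate_inter n D (val w) = digit_values (\<lambda>k. overlap_digits (t k))"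
    using translate_inter_unique[OF unique] by simp
  ultimately show thesis
    using that by blast
qed

text \<open>If \<open>x\<close> has several expansions it is rational and serves as its own witness;
  only a unique expansion needs the inclusions between digit sets.\<close>

lemma radix_self_similar_imp_rational:
  assumes "0 \<le> x" "x \<le> 1" "translate_inter n D x \<noteq> {}"
    and "0 < \<epsilon>" "radix_self_similar (translate_inter n D x \<inter> {0..\<epsilon>})"
  shows "\<exists>y\<in>\<rat>. 0 \<le> y \<and> y \<le> 1 \<and> translation_equivalent n D x y"
proof -
  have "cantor_set n D \<inter> translate (cantor_set n D) x \<noteq> {}"
    using assms(3) unfolding translate_inter_def by (auto simp: Let_def)
  then obtain t where t: "t \<in> expansions x"
    unfolding cantor_inter_translate by blast
  show ?thesis
  proof (cases "expansions x = {t}")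
    case True
    define E where "E k = overlap_digits (t k)" for k
    have x: "translate_inter n D x = digit_values E"
      unfolding E_def using translate_inter_unique[OF True] .
    have t\<Delta>: "\<And>k. t k \<in> \<Delta>"
      using t unfolding expansions_def by blast
    then have E: "admissible E"
      unfolding E_def by (rule admissible_overlap_digits)
    obtain q N where q: "1 \<le> q" "\<forall>k\<ge>N. E k \<subseteq> E (k + q)"
      using subset_shift_of_radix_self_similar[OF E assms(4)] assms(5) unfolding x by blast
    have "\<And>k. E k \<subseteq> {0..int n - 1}"
      using admissible_bound(1,2)[OF E] by auto
    then obtain M where M: "\<forall>k\<ge>M. E (k + q) = E k"
      using eventually_periodic_of_subset_shift[of N E q "{0..int n - 1}"] q(2) by blast
    obtain y where "y \<in> \<rat>" "0 \<le> y" "y \<le> 1" "translate_inter n D y = digit_values E"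
      using rational_of_periodic_overlap_digits[of t, OF t\<Delta> q(1) M[unfolded E_def]] unfolding E_def by blast
    then show ?thesis
      using x unfolding translation_equivalent_def by metis
  next
    case False
    then obtain s where "s \<in> expansions x" "s \<noteq> t"
      using t by blast
    then have "x \<in> \<rat>"
      using several_expansions_finite(1) t by blast
    then show ?thesis
      using assms(1,2) unfolding translation_equivalent_def by blast
  qed
qed

end

theorem theorem1p1:
  fixes n :: nat and D :: "nat set" and x :: real
  assumes "n \<ge> 3"
    and "D \<subseteq> {0..n - 1}"
    and "2 \<le> card D" and "card D < n"
    and "0 \<in> D"
    and "sparse_digits D"
    and "0 \<le> x" and "x \<le> 1"
    and "translate_inter n D x \<noteq> {}"
  shows "(\<exists>t\<in>\<rat>. 0 \<le> t \<and> t \<le> 1 \<and> translation_equivalent n D x t) \<longleftrightarrow>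
         (\<exists>\<epsilon>>0. \<exists>F.
            (\<forall>f\<in>F. \<exists>q\<ge>1. \<exists>b. f = (\<lambda>y. real n powi (- int q) * y + b)) \<and>
            self_similar_set_generated_by F (translate_inter n D x \<inter> {0..\<epsilon>}))"
proof -
  interpret sparse_radix n D
    using assms by unfold_locales auto
  have "(\<exists>t\<in>\<rat>. 0 \<le> t \<and> t \<le> 1 \<and> translation_equivalent n D x t) \<longleftrightarrow>
      (\<exists>\<epsilon>>0. radix_self_similar (translate_inter n D x \<inter> {0..\<epsilon>}))"
  proof
    assume "\<exists>t\<in>\<rat>. 0 \<le> t \<and> t \<le> 1 \<and> translation_equivalent n D x t"
    then obtain t where "t \<in> \<rat>" "translate_inter n D x = translate_inter n D t"
      unfolding translation_equivalent_def by blast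
    \<comment> \<open>As \<open>C(t) = C(x)\<close> is not empty, the result for rational numbers
      applies to \<open>t\<close>.\<close>
    then show "\<exists>\<epsilon>>0. radix_self_similar (translate_inter n D x \<inter> {0..\<epsilon>})"
      using rational_imp_radix_self_similar[of t] assms(9) by metis
  next
    assume "\<exists>\<epsilon>>0. radix_self_similar (translate_inter n D x \<inter> {0..\<epsilon>})"
    then show "\<exists>t\<in>\<rat>. 0 \<le> t \<and> t \<le> 1 \<and> translation_equivalent n D x t"
      using radix_self_similar_imp_rational assms(7-9) by blast
  qed
  then show ?thesis
    unfolding radix_self_similar_def .
qed

end
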